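(* Let $(\Omega,\mathcal{H},\hat{\mathbb{E}})$ be a regular sublinear expectation space and let $\{X_k\}_{k\ge1}\subset\mathcal{H}^d$ be a $d$-dimensional stationary sequence which is $\alpha$-mixing for some $\alpha>0$ and satisfies $\hat{\mathbb{E}}[|X_1|^2]<\infty$. If $X_1$ has no mean-uncertainty, then $$\lim_{n\to\infty}\frac1n\sum_{k=1}^nX_k=\hat{\mathbb{E}}[X_1],\quad\hat{\mathbb{E}}\text{-q.s.}$$
   Context: $\Omega$ is a nonempty set and $\mathcal{H}$ is a linear space of real-valued functions on $\Omega$ that contains the constants, contains $|X|$ whenever it contains $X$, and contains $\phi(X_1,\dots,X_n)$ for all $X_1,\dots,X_n\in\mathcal{H}$ and $\phi\in C_{lip}(\mathbb{R}^n)$ (Lipschitz functions). A sublinear expectation is a functional $\hat{\mathbb{E}}:\mathcal{H}\to\mathbb{R}$ that is monotone, preserves constants, is sub-additive, and is positively homogeneous. It is regular if $\hat{\mathbb{E}}[X_i]\to0$ whenever $X_i\in\mathcal{H}$ decrease pointwise to $0$. In the regular case let $\mathcal{P}$ be the set of all probabilities $P$ on $(\Omega,\sigma(\mathcal{H}))$ with $\int X\,dP\le\hat{\mathbb{E}}[X]$ for all $X\in\mathcal{H}$; then $\hat{\mathbb{E}}[X]=\sup_{P\in\mathcal{P}}\int X\,dP$. A property holds $\hat{\mathbb{E}}$-q.s. if it holds on a set $A\in\sigma(\mathcal{H})$ with $\sup_{P\in\mathcal{P}}P(A^c)=0$. For $X=(X^1,\dots,X^d)\in\mathcal{H}^d$,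 $|X|:=\sum_i|X^i|$ and $\hat{\mathbb{E}}[X]:=(\hat{\mathbb{E}}[X^1],\dots,\hat{\mathbb{E}}[X^d])$. An element $X\in\mathcal{H}$ has no mean-uncertainty if $\hat{\mathbb{E}}[-X]=-\hat{\mathbb{E}}[X]$; a vector has none if each component has none. Writing $\hat{\mathbb{E}}[|X_1|^2]<\infty$ presupposes $|X_1|^2\in\mathcal{H}$. Stationary: for all $n\ge1$ and indices $t,t_1,\dots,t_n\in\mathbb{N}$, $(X_{t_1},\dots,X_{t_n})$ and $(X_{t+t_1},\dots,X_{t+t_n})$ are identically distributed, i.e. $\hat{\mathbb{E}}[\psi(\cdot)]$ takes the same value on both for every Lipschitz $\psi$. $\alpha$-mixing (for a given $\alpha>0$): there exists $c_X>0$ such that for all nonempty finite $\Lambda^1,\Lambda^2\subset\mathbb{N}$ with $\max\Lambda^1\le\min\Lambda^2$ and all $\phi\in C_{lip}(\mathbb{R}^{2d})$ with Lipschitz constant $l_\phi>0$, $$\big|\hat{\mathbb{E}}[\phi(\bar X_{\Lambda^1},\bar X_{\Lambda^2})]-\hat{\mathbb{E}}\big[\hat{\mathbb{E}}[\phi(x,\bar X_{\Lambda^2})]|_{x=\bar X_{\Lambda^1}}\big]\big|\le c_Xl_\phi e^{-\alpha|\min\Lambda^2-\max\Lambda^1|},$$ where $\bar X_{\Lambda}=\frac1{|\Lambda|}\sum_{u\in\Lambda}X_u$. *)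

theory Defs
  imports "HOL-Analysis.Analysis" "HOL-Probability.Probability"
begin

text \<open>
  Points of \<open>\<real>\<^sup>I\<close>, for a finite index set \<open>I\<close>, are represented by functions on a type containing
  \<open>I\<close>. The Lipschitz bound involves only the coordinates in \<open>I\<close>, so it forces the function to
  ignore all other coordinates. As for random vectors, the norm is the sum of the absolute values
  of the coordinates.
\<close>

definition lipschitz_with :: "'i set \<Rightarrow> real \<Rightarrow> (('i \<Rightarrow> real) \<Rightarrow> real) \<Rightarrow> bool" where
  "lipschitz_with I l \<phi> \<longleftrightarrow> (\<forall>x y. \<bar>\<phi> x - \<phi> y\<bar> \<le> l * (\<Sum>i\<in>I. \<bar>x i - y i\<bar>))"

definition C_lip :: "'i set \<Rightarrow> (('i \<Rightarrow> real) \<Rightarrow> real) set" where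
  "C_lip I = {\<phi>. \<exists>l. lipschitz_with I l \<phi>}"

text \<open>
  The sample space \<open>\<Omega>\<close> is the type \<open>'w\<close>. The functional \<open>E\<close> is a total function, but it is
  constrained and used only on \<open>H\<close>.
\<close>

locale sublinear_expectation_space =
  fixes H :: "('w \<Rightarrow> real) set" and E :: "('w \<Rightarrow> real) \<Rightarrow> real"
  assumes const_mem: "(\<lambda>_. c) \<in> H"
    and add_mem: "\<lbrakk>X \<in> H; Y \<in> H\<rbrakk> \<Longrightarrow> (\<lambda>\<omega>. X \<omega> + Y \<omega>) \<in> H"
    and scale_mem: "X \<in> H \<Longrightarrow> (\<lambda>\<omega>. c * X \<omega>) \<in> H"
    and abs_mem: "X \<in> H \<Longrightarrow> (\<lambda>\<omega>. \<bar>X \<omega>\<bar>) \<in> H"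
    and lip_mem: "\<And>(n::nat) Z \<phi>. \<lbrakk>\<And>j. j < n \<Longrightarrow> Z j \<in> H; \<phi> \<in> C_lip {..<n}\<rbrakk>
                    \<Longrightarrow> (\<lambda>\<omega>. \<phi> (\<lambda>j. Z j \<omega>)) \<in> H"
    and mono: "\<lbrakk>X \<in> H; Y \<in> H; \<And>\<omega>. X \<omega> \<le> Y \<omega>\<rbrakk> \<Longrightarrow> E X \<le> E Y"
    and const: "E (\<lambda>_. c) = c"
    and subadditive: "\<lbrakk>X \<in> H; Y \<in> H\<rbrakk> \<Longrightarrow> E (\<lambda>\<omega>. X \<omega> + Y \<omega>) \<le> E X + E Y"
    and pos_homogeneous: "\<lbrakk>X \<in> H; c \<ge> 0\<rbrakk> \<Longrightarrow> E (\<lambda>\<omega>. c * X \<omega>) = c * E X"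

locale regular_sublinear_expectation_space = sublinear_expectation_space +
  assumes regular: "\<lbrakk>\<And>i::nat. Z i \<in> H; \<And>\<omega>. decseq (\<lambda>i. Z i \<omega>); \<And>\<omega>. (\<lambda>i. Z i \<omega>) \<longlonglongrightarrow> 0\<rbrakk>
                      \<Longrightarrow> (\<lambda>i. E (Z i)) \<longlonglongrightarrow> 0"

definition sigma_of :: "('w \<Rightarrow> real) set \<Rightarrow> 'w measure" where
  "sigma_of H = sigma UNIV {X -` B | X B. X \<in> H \<and> B \<in> sets borel}"

text \<open>
  The Bochner integral of a non-integrable function is \<open>0\<close>, so integrability is required
  explicitly. It is implicit in the bound on the integrals, since \<open>H\<close> is closed under absolute
  values.
\<close>

definition representing_probs ::
    "('w \<Rightarrow> real) set \<Rightarrow> (('w \<Rightarrow> real) \<Rightarrow> real) \<Rightarrow> 'w measure set" where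
  "representing_probs H E =
     {P. prob_space P \<and> sets P = sets (sigma_of H) \<and>
         (\<forall>X\<in>H. integrable P X \<and> integral\<^sup>L P X \<le> E X)}"

definition quasi_surely ::
    "('w \<Rightarrow> real) set \<Rightarrow> (('w \<Rightarrow> real) \<Rightarrow> real) \<Rightarrow> ('w \<Rightarrow> bool) \<Rightarrow> bool" where
  "quasi_surely H E Q \<longleftrightarrow>
     (\<exists>A\<in>sets (sigma_of H). (SUP P\<in>representing_probs H E. emeasure P (- A)) = 0 \<and> (\<forall>\<omega>\<in>A. Q \<omega>))"

definition vec_mem :: "('w \<Rightarrow> real) set \<Rightarrow> ('w \<Rightarrow> real ^ 'd) \<Rightarrow> bool" where
  "vec_mem H X \<longleftrightarrow> (\<forall>i. (\<lambda>\<omega>. X \<omega> $ i) \<in> H)"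

definition vec_expectation :: "(('w \<Rightarrow> real) \<Rightarrow> real) \<Rightarrow> ('w \<Rightarrow> real ^ 'd) \<Rightarrow> real ^ 'd" where
  "vec_expectation E X = (\<chi> i. E (\<lambda>\<omega>. X \<omega> $ i))"

definition norm1 :: "real ^ 'd \<Rightarrow> real" where
  "norm1 x = (\<Sum>i\<in>UNIV. \<bar>x $ i\<bar>)"

definition no_mean_uncertainty :: "(('w \<Rightarrow> real) \<Rightarrow> real) \<Rightarrow> ('w \<Rightarrow> real) \<Rightarrow> bool" where
  "no_mean_uncertainty E X \<longleftrightarrow> E (\<lambda>\<omega>. - X \<omega>) = - E X"

definition vec_no_mean_uncertainty :: "(('w \<Rightarrow> real) \<Rightarrow> real) \<Rightarrow> ('w \<Rightarrow> real ^ 'd) \<Rightarrow> bool" where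
  "vec_no_mean_uncertainty E X \<longleftrightarrow> (\<forall>i. no_mean_uncertainty E (\<lambda>\<omega>. X \<omega> $ i))"

text \<open>An \<open>n\<close>-tuple of \<open>d\<close>-dimensional random vectors takes values in \<open>\<real>\<^sup>I\<close> for
  \<open>I = {..<n} \<times> UNIV\<close>.\<close>

definition identically_distributed ::
    "(('w \<Rightarrow> real) \<Rightarrow> real) \<Rightarrow> nat \<Rightarrow> (nat \<Rightarrow> 'w \<Rightarrow> real ^ 'd) \<Rightarrow> (nat \<Rightarrow> 'w \<Rightarrow> real ^ 'd) \<Rightarrow> bool" where
  "identically_distributed E n Y Z \<longleftrightarrow>
     (\<forall>\<psi>\<in>C_lip ({..<n} \<times> (UNIV :: 'd set)).
        E (\<lambda>\<omega>. \<psi> (\<lambda>(j, i). Y j \<omega> $ i)) = E (\<lambda>\<omega>. \<psi> (\<lambda>(j, i). Z j \<omega> $ i)))"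

text \<open>Sequences are indexed by the positive integers; the value at index \<open>0\<close> is irrelevant.\<close>

definition stationary :: "(('w \<Rightarrow> real) \<Rightarrow> real) \<Rightarrow> (nat \<Rightarrow> 'w \<Rightarrow> real ^ 'd) \<Rightarrow> bool" where
  "stationary E X \<longleftrightarrow>
     (\<forall>n\<ge>1. \<forall>t\<ge>1. \<forall>s. (\<forall>j<n. s j \<ge> 1) \<longrightarrow>
        identically_distributed E n (\<lambda>j. X (s j)) (\<lambda>j. X (t + s j)))"

definition block_mean :: "(nat \<Rightarrow> 'w \<Rightarrow> real ^ 'd) \<Rightarrow> nat set \<Rightarrow> 'w \<Rightarrow> real ^ 'd" where
  "block_mean X \<Lambda> \<omega> = (1 / real (card \<Lambda>)) *\<^sub>R (\<Sum>u\<in>\<Lambda>. X u \<omega>)"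

definition vec_pair :: "real ^ 'd \<Rightarrow> real ^ 'd \<Rightarrow> 'd + 'd \<Rightarrow> real" where
  "vec_pair x y = case_sum (\<lambda>i. x $ i) (\<lambda>i. y $ i)"

definition alpha_mixing ::
    "(('w \<Rightarrow> real) \<Rightarrow> real) \<Rightarrow> real \<Rightarrow> (nat \<Rightarrow> 'w \<Rightarrow> real ^ 'd) \<Rightarrow> bool" where
  "alpha_mixing E \<alpha> X \<longleftrightarrow>
     (\<exists>c>0. \<forall>\<Lambda>1 \<Lambda>2. \<Lambda>1 \<noteq> {} \<and> finite \<Lambda>1 \<and> \<Lambda>1 \<subseteq> {1..} \<and> \<Lambda>2 \<noteq> {} \<and> finite \<Lambda>2 \<and> \<Lambda>2 \<subseteq> {1..} \<and>
        Max \<Lambda>1 \<le> Min \<Lambda>2 \<longrightarrow>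
        (\<forall>\<phi> l. l > 0 \<and> lipschitz_with (UNIV :: ('d + 'd) set) l \<phi> \<longrightarrow>
           \<bar>E (\<lambda>\<omega>. \<phi> (vec_pair (block_mean X \<Lambda>1 \<omega>) (block_mean X \<Lambda>2 \<omega>))) -
            E (\<lambda>\<omega>. E (\<lambda>\<omega>'. \<phi> (vec_pair (block_mean X \<Lambda>1 \<omega>) (block_mean X \<Lambda>2 \<omega>'))))\<bar>
           \<le> c * l * exp (- \<alpha> * \<bar>real (Min \<Lambda>2) - real (Max \<Lambda>1)\<bar>)))"

end

theory Submission
  imports Defs
begin

text \<open>
  Fix a representing probability \<open>P\<close> and one centred coordinate \<open>Y\<close>. Mixing only applies to
  Lipschitz functions, so it is used for the product of the variables clipped at level \<open>N\<close>, whose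
  Lipschitz constant is \<open>N\<close>. Since the mean is certain, the inner expectation of the clipped
  product is \<open>O(1/N)\<close>, which yields \<open>P\<close>-covariances bounded by \<open>C/N + c N r\<^sup>k\<close> at lag \<open>k\<close>, with
  \<open>r = exp (-\<alpha>) < 1\<close>.
  For averages over \<open>n = m\<^sup>4\<close> terms take \<open>N = m\<^sup>2\<close>: then the mean clipping error, the
  second moment of the clipped average and the second moment of the normalised fluctuation between
  \<open>m\<^sup>4\<close> and \<open>(m+1)\<^sup>4\<close> are all \<open>O(1/m\<^sup>2)\<close>, hence summable, and all three
  tend to \<open>0\<close> almost surely.
\<close>

section \<open>Symmetric truncation of real numbers\<close>

definition clip :: "real \<Rightarrow> real \<Rightarrow> real" where
  "clip N x = max (- N) (min N x)"

lemma abs_clip_le: "0 \<le> N \<Longrightarrow> \<bar>clip N x\<bar> \<le> N"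
  and abs_clip_le_abs: "0 \<le> N \<Longrightarrow> \<bar>clip N x\<bar> \<le> \<bar>x\<bar>"
  and clip_lipschitz: "\<bar>clip N x - clip N y\<bar> \<le> \<bar>x - y\<bar>"
  by (auto simp: clip_def)

lemma clip_eq: "\<bar>x\<bar> \<le> N \<Longrightarrow> clip N x = x"
  by (auto simp: clip_def)

text \<open>There is no error up to level \<open>N\<close>; beyond it the error is at most
  \<open>\<bar>x\<bar>\<close>, and \<open>N < \<bar>x\<bar>\<close> gives
  \<open>\<bar>x\<bar> \<le> x\<^sup>2 / N\<close>. Bounded second moments therefore make the mean
  clipping error O(1/N).\<close>

lemma clip_tail:
  assumes "N > 0"
  shows "\<bar>x - clip N x\<bar> \<le> x\<^sup>2 / N"
proof (cases "\<bar>x\<bar> \<le> N")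
  case True
  then show ?thesis using assms by (simp add: clip_eq)
next
  case False
  then have "N * \<bar>x\<bar> \<le> \<bar>x\<bar> * \<bar>x\<bar>" by (intro mult_right_mono) auto
  then have "\<bar>x\<bar> \<le> x\<^sup>2 / N"
    using assms by (simp add: field_simps power2_eq_square)
  moreover have "\<bar>x - clip N x\<bar> \<le> \<bar>x\<bar>"
    using assms by (auto simp: clip_def)
  ultimately show ?thesis by linarith
qed

lemma borel_measurable_clip [measurable]: "clip N \<in> borel_measurable borel"
  unfolding clip_def by measurable

text \<open>Both factors are 1-Lipschitz and bounded by \<open>N\<close>, so exchanging one argument
  at a time costs \<open>N\<close> times its displacement. This \<open>N\<close> is the Lipschitz
  constant that later enters the mixing inequality.\<close>

lemma clip_mult_lipschitz:
  assumes "0 \<le> N"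
  shows "\<bar>clip N x * clip N y - clip N x' * clip N y'\<bar> \<le> N * (\<bar>x - x'\<bar> + \<bar>y - y'\<bar>)"
proof -
  have "clip N x * clip N y - clip N x' * clip N y'
      = (clip N x - clip N x') * clip N y + clip N x' * (clip N y - clip N y')"
    by (simp add: algebra_simps)
  also have "\<bar>\<dots>\<bar> \<le> \<bar>clip N x - clip N x'\<bar> * \<bar>clip N y\<bar> + \<bar>clip N x'\<bar> * \<bar>clip N y - clip N y'\<bar>"
    by (metis abs_mult abs_triangle_ineq)
  also have "\<dots> \<le> \<bar>x - x'\<bar> * N + N * \<bar>y - y'\<bar>"
    using assms by (intro add_mono mult_mono abs_clip_le clip_lipschitz) auto
  finally show ?thesis by (simp add: algebra_simps)
qed

section \<open>Almost sure convergence and second moments under one probability\<close>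

context prob_space
begin

text \<open>By monotone convergence the series of the \<open>f m\<close> has finite expectation, so
  it converges almost surely and its terms vanish in the limit.\<close>

lemma AE_tendsto_0_of_summable_expectation:
  fixes f :: "nat \<Rightarrow> 'a \<Rightarrow> real"
  assumes f: "\<And>m. integrable M (f m)" "\<And>m x. 0 \<le> f m x"
    and B: "summable B" "\<And>m. expectation (f m) \<le> B m"
  shows "AE x in M. (\<lambda>m. f m x) \<longlonglongrightarrow> 0"
proof -
  have sm: "summable (\<lambda>m. expectation (f m))"
    by (rule summable_comparison_test'[OF B(1)])
       (use f B in \<open>auto simp: integral_nonneg_AE\<close>)
  have meas [measurable]: "\<And>m. f m \<in> borel_measurable M" using f by auto
  have "(\<integral>\<^sup>+x. (\<Sum>m. ennreal (f m x)) \<partial>M) = (\<Sum>m. \<integral>\<^sup>+x. ennreal (f m x) \<partial>M)"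
    by (rule nn_integral_suminf) measurable
  also have "\<dots> = (\<Sum>m. ennreal (expectation (f m)))"
    using f by (intro suminf_cong nn_integral_eq_integral) auto
  also have "\<dots> \<noteq> \<infinity>"
    using sm f by (simp add: suminf_ennreal2 integral_nonneg_AE)
  finally have "AE x in M. (\<Sum>m. ennreal (f m x)) \<noteq> \<infinity>"
    by (intro nn_integral_PInf_AE) auto
  then show ?thesis
  proof eventually_elim
    case (elim x)
    then have "summable (\<lambda>m. f m x)" using f by (intro summable_suminf_not_top) auto
    then show ?case by (rule summable_LIMSEQ_zero)
  qed
qed

text \<open>Induction on the number of terms: a new term adds its own second moment and twice its
  products with all earlier terms, hence at most \<open>K + 2 * D\<close>. The bound
  \<open>D\<close> is asked only for \<open>k \<le> n\<close>, so it may grow with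
  \<open>n\<close>.\<close>

lemma expectation_sum_square_le:
  fixes Z :: "nat \<Rightarrow> 'a \<Rightarrow> real"
  assumes int: "\<And>j k. 1 \<le> j \<Longrightarrow> 1 \<le> k \<Longrightarrow> integrable M (\<lambda>x. Z j x * Z k x)"
    and diag: "\<And>k. 1 \<le> k \<Longrightarrow> expectation (\<lambda>x. (Z k x)\<^sup>2) \<le> K"
    and cov: "\<And>k. 1 \<le> k \<Longrightarrow> k \<le> n \<Longrightarrow> (\<Sum>j=1..<k. expectation (\<lambda>x. Z j x * Z k x)) \<le> D"
  shows "integrable M (\<lambda>x. (\<Sum>k=1..n. Z k x)\<^sup>2)"
    and "expectation (\<lambda>x. (\<Sum>k=1..n. Z k x)\<^sup>2) \<le> real n * (K + 2 * D)"
proof -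
  have I: "integrable M (\<lambda>x. (\<Sum>k=1..l. Z k x)\<^sup>2)" for l
    unfolding power2_eq_square sum_product by (intro Bochner_Integration.integrable_sum int) auto
  then show "integrable M (\<lambda>x. (\<Sum>k=1..n. Z k x)\<^sup>2)" .
  have "l \<le> n \<Longrightarrow> expectation (\<lambda>x. (\<Sum>k=1..l. Z k x)\<^sup>2) \<le> real l * (K + 2 * D)" for l
  proof (induction l)
    case 0
    then show ?case by simp
  next
    case (Suc l)
    have sq: "integrable M (\<lambda>x. (Z (Suc l) x)\<^sup>2)"
      unfolding power2_eq_square by (intro int) auto
    have cr: "integrable M (\<lambda>x. \<Sum>j=1..<Suc l. Z j x * Z (Suc l) x)"
      by (intro Bochner_Integration.integrable_sum int) auto
    have "(\<lambda>x. (\<Sum>k=1..Suc l. Z k x)\<^sup>2)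
        = (\<lambda>x. (\<Sum>k=1..l. Z k x)\<^sup>2 + (Z (Suc l) x)\<^sup>2 + 2 * (\<Sum>j=1..<Suc l. Z j x * Z (Suc l) x))"
      by (simp add: fun_eq_iff power2_eq_square algebra_simps sum_distrib_left sum_distrib_right
            atLeastLessThanSuc_atLeastAtMost)
    then have "expectation (\<lambda>x. (\<Sum>k=1..Suc l. Z k x)\<^sup>2)
        = expectation (\<lambda>x. (\<Sum>k=1..l. Z k x)\<^sup>2) + expectation (\<lambda>x. (Z (Suc l) x)\<^sup>2)
          + 2 * expectation (\<lambda>x. \<Sum>j=1..<Suc l. Z j x * Z (Suc l) x)"
      using I sq cr by simp
    also have "expectation (\<lambda>x. \<Sum>j=1..<Suc l. Z j x * Z (Suc l) x)
        = (\<Sum>j=1..<Suc l. expectation (\<lambda>x. Z j x * Z (Suc l) x))"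
      by (intro Bochner_Integration.integral_sum int) auto
    also have "expectation (\<lambda>x. (\<Sum>k=1..l. Z k x)\<^sup>2) + expectation (\<lambda>x. (Z (Suc l) x)\<^sup>2) + 2 * \<dots>
        \<le> real l * (K + 2 * D) + K + 2 * D"
      using Suc diag[of "Suc l"] cov[of "Suc l"] by (intro add_mono mult_left_mono) auto
    finally show ?case by (simp add: algebra_simps)
  qed
  then show "expectation (\<lambda>x. (\<Sum>k=1..n. Z k x)\<^sup>2) \<le> real n * (K + 2 * D)" by simp
qed

end

section \<open>Real sequences and series\<close>

lemma sum_geometric_lag_le:
  fixes r :: real
  assumes "0 \<le> r" "r < 1"
  shows "(\<Sum>j=1..<k. r ^ (k - j)) \<le> 1 / (1 - r)"
proof -
  have "(\<Sum>j=1..<k. r ^ (k - j)) = (\<Sum>i=1..<k. r ^ i)"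
    by (rule sum.reindex_bij_witness[of _ "\<lambda>i. k - i" "\<lambda>i. k - i"]) auto
  also have "\<dots> \<le> (\<Sum>i. r ^ i)"
    using assms by (intro sum_le_suminf summable_geometric) auto
  finally show ?thesis using assms by (simp add: suminf_geometric)
qed

text \<open>For n between \<open>m^4\<close> and \<open>(m+1)^4\<close>, the sum up to n differs
  from the sum up to \<open>m^4\<close> by at most the absolute sum over the whole gap, and dividing
  by \<open>m^4\<close> instead of n only enlarges the quotient.\<close>

lemma averages_tendsto_0_of_subsequence:
  fixes y :: "nat \<Rightarrow> real"
  assumes a: "(\<lambda>m. \<bar>\<Sum>k=1..m^4. y k\<bar> / real m ^ 4) \<longlonglongrightarrow> 0"
    and b: "(\<lambda>m. (\<Sum>k=m^4+1..(m+1)^4. \<bar>y k\<bar>) / real m ^ 4) \<longlonglongrightarrow> 0"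
  shows "(\<lambda>n. (\<Sum>k=1..n. y k) / real n) \<longlonglongrightarrow> 0"
proof (rule LIMSEQ_I)
  fix e :: real assume "e > 0"
  let ?h = "\<lambda>m. \<bar>\<Sum>k=1..m^4. y k\<bar> / real m ^ 4 + (\<Sum>k=m^4+1..(m+1)^4. \<bar>y k\<bar>) / real m ^ 4"
  have "?h \<longlonglongrightarrow> 0" using tendsto_add[OF a b] by simp
  then obtain M where M: "\<And>m. m \<ge> M \<Longrightarrow> \<bar>?h m\<bar> < e"
    using \<open>e > 0\<close> by (metis (no_types, lifting) LIMSEQ_D diff_zero real_norm_def)
  show "\<exists>no. \<forall>n\<ge>no. norm ((\<Sum>k=1..n. y k) / real n - 0) < e"
  proof (intro exI allI impI)
    \<comment> \<open>The threshold uses \<open>Suc M\<close> rather than \<open>M\<close>, so that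
      the \<open>m\<close> chosen below is also positive and division by \<open>m ^ 4\<close> is
      genuine.\<close>
    fix n assume n: "n \<ge> Suc M ^ 4"
    define m where "m = Max {m. m ^ 4 \<le> n}"
    have sub: "{m. m ^ 4 \<le> n} \<subseteq> {..n}"
    proof
      fix x assume "x \<in> {m. m ^ 4 \<le> n}"
      moreover have "x \<le> x ^ 4" by (cases "x = 0") (auto intro: self_le_power)
      ultimately show "x \<in> {..n}" by auto
    qed
    have fin: "finite {m. m ^ 4 \<le> n}" using sub finite_subset by blast
    have m4: "m ^ 4 \<le> n"
      using Max_in[OF fin] n unfolding m_def by auto
    have mM: "m \<ge> Suc M" unfolding m_def using fin n by (intro Max_ge) auto
    have m1: "n < (m + 1) ^ 4"
    proof (rule ccontr)
      assume "\<not> ?thesis"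
      then have "m + 1 \<le> m" unfolding m_def by (intro Max_ge fin) auto
      then show False by simp
    qed
    have "(\<Sum>k=1..n. y k) = (\<Sum>k=1..m^4. y k) + (\<Sum>k=m^4+1..n. y k)"
      using m4 by (subst sum.union_disjoint[symmetric]) (auto intro: sum.cong)
    also have "\<bar>\<dots>\<bar> \<le> \<bar>\<Sum>k=1..m^4. y k\<bar> + (\<Sum>k=m^4+1..n. \<bar>y k\<bar>)"
      by (rule order_trans[OF abs_triangle_ineq]) (intro add_left_mono sum_abs)
    also have "\<dots> \<le> \<bar>\<Sum>k=1..m^4. y k\<bar> + (\<Sum>k=m^4+1..(m+1)^4. \<bar>y k\<bar>)"
      using m1 by (intro add_left_mono sum_mono2) auto
    finally have "\<bar>\<Sum>k=1..n. y k\<bar> / real n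
        \<le> (\<bar>\<Sum>k=1..m^4. y k\<bar> + (\<Sum>k=m^4+1..(m+1)^4. \<bar>y k\<bar>)) / real (m ^ 4)"
      using m4 mM by (intro frac_le) (auto intro: sum_nonneg)
    also have "\<dots> = ?h m" by (simp add: add_divide_distrib)
    also have "\<dots> < e" using M[of m] mM by linarith
    finally show "norm ((\<Sum>k=1..n. y k) / real n - 0) < e" by simp
  qed
qed


text \<open>All quantifiers on the right range over natural numbers, which exhibits convergence sets
  as countable combinations of measurable sets.\<close>

lemma tendsto_0_iff_inverse_Suc:
  fixes s :: "nat \<Rightarrow> real"
  shows "s \<longlonglongrightarrow> 0 \<longleftrightarrow> (\<forall>p. \<exists>m. \<forall>n\<ge>m. \<bar>s n\<bar> < inverse (real (Suc p)))"
proof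
  assume "s \<longlonglongrightarrow> 0"
  then show "\<forall>p. \<exists>m. \<forall>n\<ge>m. \<bar>s n\<bar> < inverse (real (Suc p))"
    using LIMSEQ_D[of s 0 "inverse (real (Suc _))"] by simp
next
  assume *: "\<forall>p. \<exists>m. \<forall>n\<ge>m. \<bar>s n\<bar> < inverse (real (Suc p))"
  show "s \<longlonglongrightarrow> 0"
  proof (rule LIMSEQ_I)
    fix e :: real assume "0 < e"
    then obtain p where "inverse (real (Suc p)) < e" using reals_Archimedean by blast
    moreover obtain m where "\<forall>n\<ge>m. \<bar>s n\<bar> < inverse (real (Suc p))" using * by blast
    ultimately show "\<exists>m. \<forall>n\<ge>m. norm (s n - 0) < e" by (intro exI[of _ m]) auto
  qed
qed

lemma summable_const_over_square: "summable (\<lambda>m. (C::real) / real m ^ 2)"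
proof -
  have "summable (\<lambda>m. C * inverse (real m ^ 2))"
    by (intro summable_mult inverse_power_summable) simp
  then show ?thesis by (simp add: field_simps)
qed

section \<open>Strong law from second moments and clipped covariances\<close>

text \<open>The covariance bound trades the clipping error \<open>C / N\<close> against the growth
  of the mixing term with \<open>N\<close>. For each \<open>m\<close> one level \<open>N\<close> is
  applied to all of the first \<open>m^4\<close> terms.\<close>

lemma (in prob_space) strong_law_of_clipped_covariances:
  fixes Y :: "nat \<Rightarrow> 'a \<Rightarrow> real"
  assumes meas: "\<And>k. 1 \<le> k \<Longrightarrow> Y k \<in> borel_measurable M"
    and sq: "\<And>k. 1 \<le> k \<Longrightarrow> integrable M (\<lambda>x. (Y k x)\<^sup>2)"
            "\<And>k. 1 \<le> k \<Longrightarrow> expectation (\<lambda>x. (Y k x)\<^sup>2) \<le> K"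
    and cov: "\<And>N j k. 0 < N \<Longrightarrow> 1 \<le> j \<Longrightarrow> j < k \<Longrightarrow>
        expectation (\<lambda>x. clip N (Y j x) * clip N (Y k x)) \<le> C / N + c * N * r ^ (k - j)"
    and nonneg: "0 \<le> C" "0 \<le> c" and r: "0 \<le> r" "r < 1"
  shows "AE x in M. (\<lambda>n. (\<Sum>k=1..n. Y k x) / real n) \<longlonglongrightarrow> 0"
proof -
  have K: "0 \<le> K"
    using order_trans[OF integral_nonneg_AE sq(2)[of 1]] by simp
  \<comment> \<open>\<open>A\<close> dominates the clipping error, \<open>B\<close> is the square of the clipped average, and \<open>G\<close>
    dominates the square of the fluctuation between \<open>m\<^sup>4\<close> and \<open>(m+1)\<^sup>4\<close>.\<close>
  define A where "A m x = (\<Sum>k=1..m^4. (Y k x)\<^sup>2 / real m ^ 2) / real m ^ 4" for m x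
  define B where "B m x = (\<Sum>k=1..m^4. clip (real m ^ 2) (Y k x))\<^sup>2 / real m ^ 8" for m x
  define L where "L m = (m+1)^4 - m^4" for m :: nat
  define G where "G m x = real (L m) * (\<Sum>k=m^4+1..(m+1)^4. (Y k x)\<^sup>2) / real m ^ 8" for m x

  have "AE x in M. (\<lambda>m. A m x) \<longlonglongrightarrow> 0"
  proof (rule AE_tendsto_0_of_summable_expectation[OF _ _ summable_const_over_square])
    show "integrable M (A m)" for m
      unfolding A_def by (intro integrable_divide Bochner_Integration.integrable_sum sq) auto
    show "0 \<le> A m x" for m x by (auto simp: A_def intro!: divide_nonneg_nonneg sum_nonneg)
    show "expectation (A m) \<le> K / real m ^ 2" for m
    proof -
      have "expectation (A m) = (\<Sum>k=1..m^4. expectation (\<lambda>x. (Y k x)\<^sup>2) / real m ^ 2) / real m ^ 4"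
        unfolding A_def using sq(1) by (simp add: Bochner_Integration.integral_sum)
      also have "\<dots> \<le> (\<Sum>k=1..m^4. K / real m ^ 2) / real m ^ 4"
        by (intro divide_right_mono sum_mono sq(2)) auto
      also have "\<dots> = K / real m ^ 2"
        by (simp add: divide_simps)
      finally show ?thesis .
    qed
  qed
  moreover have "AE x in M. (\<lambda>m. B m x) \<longlonglongrightarrow> 0"
  proof (rule AE_tendsto_0_of_summable_expectation[OF _ _ summable_const_over_square])
    \<comment> \<open>With \<open>N = m^2\<close>, at most \<open>m^4\<close> earlier indices
      contribute \<open>C / m^2\<close> each, in total \<open>C * m^2\<close>; the mixing terms
      contribute \<open>c * m^2\<close> times a geometric series.\<close>
    let ?D = "\<lambda>m. real m ^ 2 * (C + c * (1 / (1 - r)))"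
    have int: "integrable M (\<lambda>x. clip (real m ^ 2) (Y j x) * clip (real m ^ 2) (Y k x))"
      if "1 \<le> j" "1 \<le> k" for m j k
    proof (rule integrable_const_bound[where B="real m ^ 2 * real m ^ 2"])
      note [measurable] = meas[OF that(1)] meas[OF that(2)]
      show "(\<lambda>x. clip (real m ^ 2) (Y j x) * clip (real m ^ 2) (Y k x)) \<in> borel_measurable M"
        by measurable
      show "AE x in M. norm (clip (real m ^ 2) (Y j x) * clip (real m ^ 2) (Y k x)) \<le> real m ^ 2 * real m ^ 2"
        unfolding real_norm_def abs_mult by (intro AE_I2 mult_mono abs_clip_le) auto
    qed
    have diag: "expectation (\<lambda>x. (clip (real m ^ 2) (Y k x))\<^sup>2) \<le> K" if "1 \<le> k" for m k
    proof -
      have "expectation (\<lambda>x. (clip (real m ^ 2) (Y k x))\<^sup>2) \<le> expectation (\<lambda>x. (Y k x)\<^sup>2)"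
        using int[OF that that, of m] sq(1)[OF that]
        by (intro integral_mono) (auto simp: power2_eq_square[symmetric] abs_le_square_iff[symmetric] intro: abs_clip_le_abs)
      then show ?thesis using sq(2)[OF that] by simp
    qed
    have D: "(\<Sum>j=1..<k. expectation (\<lambda>x. clip (real m ^ 2) (Y j x) * clip (real m ^ 2) (Y k x))) \<le> ?D m"
      if "1 \<le> k" "k \<le> m ^ 4" for m k
    proof -
      have m: "0 < real m" using that by (cases "m = 0") auto
      have "(\<Sum>j=1..<k. expectation (\<lambda>x. clip (real m ^ 2) (Y j x) * clip (real m ^ 2) (Y k x)))
          \<le> (\<Sum>j=1..<k. C / real m ^ 2 + c * real m ^ 2 * r ^ (k - j))"
        using m by (intro sum_mono cov) auto
      also have "\<dots> = real (k - 1) * (C / real m ^ 2) + c * real m ^ 2 * (\<Sum>j=1..<k. r ^ (k - j))"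
        by (simp add: sum.distrib sum_distrib_left)
      also have "\<dots> \<le> real (m ^ 4) * (C / real m ^ 2) + c * real m ^ 2 * (1 / (1 - r))"
        using that nonneg r
        by (intro add_mono mult_left_mono mult_right_mono sum_geometric_lag_le of_nat_mono) auto
      also have "\<dots> = ?D m"
        using m by (simp add: field_simps power2_eq_square power4_eq_xxxx)
      finally show ?thesis .
    qed
    show "integrable M (B m)" for m
      unfolding B_def
      by (rule integrable_divide) (rule expectation_sum_square_le(1)[OF int diag D])
    show "0 \<le> B m x" for m x by (simp add: B_def)
    show "expectation (B m) \<le> (K + 2 * (C + c * (1 / (1 - r)))) / real m ^ 2" for m
    proof (cases "m = 0")
      \<comment> \<open>Division by zero yields 0, so both sides vanish at
        \<open>m = 0\<close>.\<close>
      case True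
      then show ?thesis by (simp add: B_def[abs_def])
    next
      case False
      then have m: "1 \<le> real m ^ 2" by simp
      have "expectation (B m) = expectation (\<lambda>x. (\<Sum>k=1..m^4. clip (real m ^ 2) (Y k x))\<^sup>2) / real m ^ 8"
        by (simp add: B_def[abs_def])
      also have "\<dots> \<le> real (m ^ 4) * (K + 2 * ?D m) / real m ^ 8"
        by (intro divide_right_mono expectation_sum_square_le(2)[OF int diag D]) auto
      also have "\<dots> = (K + 2 * ?D m) / real m ^ 4"
        using False by (simp add: divide_simps)
      \<comment> \<open>\<open>K\<close> is inflated by the factor \<open>m^2\<close>, which is at
        least 1, so that \<open>m^2\<close> can be factored out of the whole numerator.\<close>
      also have "\<dots> \<le> (real m ^ 2 * K + 2 * ?D m) / real m ^ 4"
        using K m mult_right_mono[OF m K] by (intro divide_right_mono) auto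
      also have "\<dots> = real m ^ 2 * (K + 2 * (C + c * (1 / (1 - r)))) / real m ^ 4"
        by (simp add: algebra_simps)
      also have "\<dots> = (K + 2 * (C + c * (1 / (1 - r)))) / real m ^ 2"
        using False by (simp add: divide_simps)
      finally show ?thesis .
    qed
  qed
  moreover have "AE x in M. (\<lambda>m. G m x) \<longlonglongrightarrow> 0"
  proof (rule AE_tendsto_0_of_summable_expectation[OF _ _ summable_const_over_square])
    show "integrable M (G m)" for m
      unfolding G_def
      by (intro integrable_divide integrable_mult_right Bochner_Integration.integrable_sum sq) auto
    show "0 \<le> G m x" for m x
      by (auto simp: G_def intro!: divide_nonneg_nonneg mult_nonneg_nonneg sum_nonneg)
    \<comment> \<open>The gap between consecutive fourth powers has length at most
      \<open>15 * m^3\<close>, where 15 = 4 + 6 + 4 + 1 is the sum of the binomial coefficients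
      involved; its square gives 225 and leaves \<open>m^6 / m^8\<close>.\<close>
    show "expectation (G m) \<le> 225 * K / real m ^ 2" for m
    proof (cases "m = 0")
      case True
      then show ?thesis by (simp add: G_def[abs_def])
    next
      case False
      have "real (L m) = 4 * real m ^ 3 + 6 * real m ^ 2 + 4 * real m + 1"
      proof -
        have "real (L m) = (1 + real m) ^ 4 - real m ^ 4"
          by (simp add: L_def of_nat_diff power_mono)
        then show ?thesis by (simp add: power4_eq_xxxx power3_eq_cube power2_eq_square algebra_simps)
      qed
      also have "\<dots> \<le> 15 * real m ^ 3"
      proof -
        have m: "1 \<le> real m" using False by simp
        show ?thesis
          using power_increasing[of 2 3 "real m", OF _ m] power_increasing[of 1 3 "real m", OF _ m] m
          by (simp only: power_one_right) linarith
      qed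
      finally have L: "real (L m) \<le> 15 * real m ^ 3" .
      have "expectation (G m)
          = real (L m) * (\<Sum>k=m^4+1..(m+1)^4. expectation (\<lambda>x. (Y k x)\<^sup>2)) / real m ^ 8"
        unfolding G_def using sq(1) by (simp add: Bochner_Integration.integral_sum)
      also have "\<dots> \<le> real (L m) * (\<Sum>k=m^4+1..(m+1)^4. K) / real m ^ 8"
        by (intro divide_right_mono mult_left_mono sum_mono sq(2)) auto
      also have "\<dots> = real (L m) ^ 2 * K / real m ^ 8"
        by (simp add: L_def power2_eq_square)
      also have "\<dots> \<le> (15 * real m ^ 3) ^ 2 * K / real m ^ 8"
        using L K by (intro divide_right_mono mult_right_mono power_mono) auto
      also have "\<dots> = 225 * K / real m ^ 2"
        using False by (simp add: divide_simps)
      finally show ?thesis .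
    qed
  qed
  ultimately show ?thesis
  proof eventually_elim
    case (elim x)
    \<comment> \<open>In this form \<open>sqrt (B m x)\<close> is the absolute value of the clipped
      average.\<close>
    have m8: "real m ^ 8 = (real m ^ 4)\<^sup>2" for m by simp
    have AB: "(\<lambda>m. A m x + sqrt (B m x)) \<longlonglongrightarrow> 0"
      using tendsto_add[OF elim(1) tendsto_real_sqrt[OF elim(2)]] by simp
    have "\<bar>\<Sum>k=1..m^4. Y k x\<bar> / real m ^ 4 \<le> A m x + sqrt (B m x)" for m
    proof (cases "m = 0")
      case True
      then show ?thesis by (simp add: A_def B_def)
    next
      case False
      let ?z = "\<lambda>k. clip (real m ^ 2) (Y k x)"
      have "\<bar>\<Sum>k=1..m^4. Y k x\<bar> = \<bar>(\<Sum>k=1..m^4. Y k x - ?z k) + (\<Sum>k=1..m^4. ?z k)\<bar>"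
        by (simp add: sum_subtractf)
      also have "\<dots> \<le> (\<Sum>k=1..m^4. \<bar>Y k x - ?z k\<bar>) + \<bar>\<Sum>k=1..m^4. ?z k\<bar>"
        by (rule order_trans[OF abs_triangle_ineq]) (intro add_right_mono sum_abs)
      also have "\<dots> \<le> (\<Sum>k=1..m^4. (Y k x)\<^sup>2 / real m ^ 2) + \<bar>\<Sum>k=1..m^4. ?z k\<bar>"
        using False by (intro add_right_mono sum_mono clip_tail) auto
      finally have "\<bar>\<Sum>k=1..m^4. Y k x\<bar> / real m ^ 4
          \<le> ((\<Sum>k=1..m^4. (Y k x)\<^sup>2 / real m ^ 2) + \<bar>\<Sum>k=1..m^4. ?z k\<bar>) / real m ^ 4"
        by (intro divide_right_mono) auto
      also have "\<dots> = A m x + sqrt (B m x)"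
        unfolding A_def B_def m8 power_divide[symmetric] real_sqrt_abs
        by (simp add: add_divide_distrib abs_divide)
      finally show ?thesis .
    qed
    then have a: "(\<lambda>m. \<bar>\<Sum>k=1..m^4. Y k x\<bar> / real m ^ 4) \<longlonglongrightarrow> 0"
      by (intro Lim_null_comparison[OF always_eventually AB]) simp
    have sG: "(\<lambda>m. sqrt (G m x)) \<longlonglongrightarrow> 0"
      using tendsto_real_sqrt[OF elim(3)] by simp
    have "(\<Sum>k=m^4+1..(m+1)^4. \<bar>Y k x\<bar>) / real m ^ 4 \<le> sqrt (G m x)" for m
    proof (rule real_le_rsqrt)
      \<comment> \<open>Cauchy-Schwarz over the \<open>L m\<close> indices of the gap.\<close>
      have "(\<Sum>k=m^4+1..(m+1)^4. \<bar>Y k x\<bar>)\<^sup>2 \<le> (\<Sum>k=m^4+1..(m+1)^4. \<bar>Y k x\<bar>\<^sup>2) * real (L m)"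
        using sum_squared_le_sum_of_squares[of "\<lambda>k. \<bar>Y k x\<bar>" "{m^4+1..(m+1)^4}"]
        by (simp add: L_def)
      then show "((\<Sum>k=m^4+1..(m+1)^4. \<bar>Y k x\<bar>) / real m ^ 4)\<^sup>2 \<le> G m x"
        unfolding G_def m8 power_divide by (intro divide_right_mono) (auto simp: mult.commute)
    qed
    then have "(\<lambda>m. (\<Sum>k=m^4+1..(m+1)^4. \<bar>Y k x\<bar>) / real m ^ 4) \<longlonglongrightarrow> 0"
      by (intro Lim_null_comparison[OF always_eventually sG]) (simp add: sum_nonneg)
    with a show ?case by (rule averages_tendsto_0_of_subsequence)
  qed
qed


text \<open>Fatou's lemma along the clipping levels: pointwise the clipped squares are eventually
  equal to the full square. This recovers second moments when the sublinear expectation controls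
  only clipped squares.\<close>

lemma (in prob_space) square_integrable_of_clip:
  fixes f :: "'a \<Rightarrow> real"
  assumes [measurable]: "f \<in> borel_measurable M"
    and bound: "\<And>m::nat. expectation (\<lambda>x. (clip (real m) (f x))\<^sup>2) \<le> K"
  shows "integrable M (\<lambda>x. (f x)\<^sup>2)" and "expectation (\<lambda>x. (f x)\<^sup>2) \<le> K"
proof -
  have K: "0 \<le> K" using order_trans[OF integral_nonneg_AE bound[of 0]] by simp
  have int: "integrable M (\<lambda>x. (clip (real m) (f x))\<^sup>2)" for m :: nat
  proof (rule integrable_const_bound[where B="(real m)\<^sup>2"])
    show "AE x in M. norm ((clip (real m) (f x))\<^sup>2) \<le> (real m)\<^sup>2"
      unfolding real_norm_def abs_power2
      by (intro AE_I2 abs_le_square_iff[THEN iffD1]) (simp add: abs_clip_le)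
  qed measurable
  have lim: "(\<lambda>m. ennreal ((clip (real m) y)\<^sup>2)) \<longlonglongrightarrow> ennreal (y\<^sup>2)" for y
  proof (rule tendsto_eventually)
    show "\<forall>\<^sub>F m in sequentially. ennreal ((clip (real m) y)\<^sup>2) = ennreal (y\<^sup>2)"
      using eventually_ge_at_top[of "nat \<lceil>\<bar>y\<bar>\<rceil>"]
    proof eventually_elim
      case (elim m)
      then have "\<bar>y\<bar> \<le> real m" by linarith
      then show ?case by (simp add: clip_eq)
    qed
  qed
  have "(\<integral>\<^sup>+x. ennreal ((f x)\<^sup>2) \<partial>M) = (\<integral>\<^sup>+x. liminf (\<lambda>m. ennreal ((clip (real m) (f x))\<^sup>2)) \<partial>M)"
    using lim by (intro nn_integral_cong) (metis lim_imp_Liminf trivial_limit_sequentially)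
  also have "\<dots> \<le> liminf (\<lambda>m. \<integral>\<^sup>+x. ennreal ((clip (real m) (f x))\<^sup>2) \<partial>M)"
    by (rule nn_integral_liminf) measurable
  also have "\<dots> \<le> ennreal K"
  proof (rule Liminf_le)
    show "\<forall>\<^sub>F m in sequentially. (\<integral>\<^sup>+x. ennreal ((clip (real m) (f x))\<^sup>2) \<partial>M) \<le> ennreal K"
      using bound by (intro always_eventually allI) (subst nn_integral_eq_integral[OF int], auto intro: ennreal_leI)
  qed simp
  finally have *: "(\<integral>\<^sup>+x. ennreal ((f x)\<^sup>2) \<partial>M) \<le> ennreal K" .
  then show i: "integrable M (\<lambda>x. (f x)\<^sup>2)"
    by (intro integrableI_bounded) (auto simp: top_unique ennreal_less_top[THEN le_less_trans[rotated]])
  show "expectation (\<lambda>x. (f x)\<^sup>2) \<le> K"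
    using * K by (subst (asm) nn_integral_eq_integral[OF i]) auto
qed

section \<open>Clipped variables under the sublinear expectation\<close>

context sublinear_expectation_space
begin

lemma minus_mem: "A \<in> H \<Longrightarrow> (\<lambda>\<omega>. - A \<omega>) \<in> H"
  using scale_mem[of A "-1"] by simp

lemma lipschitz_comp_mem:
  assumes "A \<in> H" "\<And>x y. \<bar>g x - g y\<bar> \<le> l * \<bar>x - y\<bar>"
  shows "(\<lambda>\<omega>. g (A \<omega>)) \<in> H"
proof -
  have "(\<lambda>z. g (z 0)) \<in> C_lip {..<1::nat}"
    using assms(2) by (auto simp: C_lip_def lipschitz_with_def)
  from lip_mem[OF _ this, of "\<lambda>_. A"] assms(1) show ?thesis by simp
qed

lemma clip_mem: "A \<in> H \<Longrightarrow> (\<lambda>\<omega>. clip N (A \<omega>)) \<in> H"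
  by (rule lipschitz_comp_mem[where g="clip N" and l=1]) (use clip_lipschitz in auto)

text \<open>Products of elements of \<open>H\<close> need not lie in \<open>H\<close>, but the
  clipped product is a Lipschitz function of the pair.\<close>

lemma clip_mult_mem:
  assumes "A \<in> H" "B \<in> H" "0 \<le> N"
  shows "(\<lambda>\<omega>. clip N (A \<omega>) * clip N (B \<omega>)) \<in> H"
proof -
  have "(\<lambda>z. clip N (z 0) * clip N (z 1)) \<in> C_lip {..<2::nat}"
    using clip_mult_lipschitz[OF assms(3)]
    by (auto simp: C_lip_def lipschitz_with_def numeral_2_eq_2 intro!: exI[of _ N])
  from lip_mem[OF _ this, of "\<lambda>j. if j = 0 then A else B"] assms show ?thesis by simp
qed

text \<open>Sub-additivity applied to \<open>clip N B \<le> B + \<bar>B - clip N B\<bar>\<close>.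
  Used for a variable and for its negative, it bounds the clipped mean from both sides.\<close>

lemma E_clip_le:
  assumes B: "B \<in> H" and mean: "E B \<le> 0" and N: "0 < N" and tail: "E (\<lambda>\<omega>. \<bar>B \<omega> - clip N (B \<omega>)\<bar>) \<le> d"
  shows "E (\<lambda>\<omega>. clip N (B \<omega>)) \<le> d"
proof -
  have t: "(\<lambda>\<omega>. \<bar>B \<omega> - clip N (B \<omega>)\<bar>) \<in> H"
    using abs_mem[OF add_mem[OF B minus_mem[OF clip_mem[OF B]]]] by simp
  have "E (\<lambda>\<omega>. clip N (B \<omega>)) \<le> E (\<lambda>\<omega>. B \<omega> + \<bar>B \<omega> - clip N (B \<omega>)\<bar>)"
    by (intro mono clip_mem add_mem B t) auto
  also have "\<dots> \<le> E B + E (\<lambda>\<omega>. \<bar>B \<omega> - clip N (B \<omega>)\<bar>)" by (intro subadditive B t)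
  finally show ?thesis using mean tail by simp
qed

text \<open>Mixing replaces the joint expectation by the iterated one at cost \<epsilon>. There,
  with the clipped first factor frozen at t, the inner expectation is at most
  \<open>d * \<bar>t\<bar>\<close>, whatever the sign of t.\<close>

lemma E_product_clip_le:
  assumes A: "A \<in> H" and B: "B \<in> H" and N: "0 < N"
    and d: "E (\<lambda>\<omega>. clip N (B \<omega>)) \<le> d" "E (\<lambda>\<omega>. - clip N (B \<omega>)) \<le> d" "0 \<le> d"
    and abs: "E (\<lambda>\<omega>. \<bar>A \<omega>\<bar>) \<le> m"
    and mix: "\<bar>E (\<lambda>\<omega>. clip N (A \<omega>) * clip N (B \<omega>)) -
                E (\<lambda>\<omega>. E (\<lambda>\<omega>'. clip N (A \<omega>) * clip N (B \<omega>')))\<bar> \<le> \<epsilon>"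
  shows "E (\<lambda>\<omega>. clip N (A \<omega>) * clip N (B \<omega>)) \<le> m * d + \<epsilon>"
proof -
  let ?a = "E (\<lambda>\<omega>. clip N (B \<omega>))" and ?b = "E (\<lambda>\<omega>. - clip N (B \<omega>))"
  \<comment> \<open>Positive homogeneity acts separately on the positive part
    \<open>(\<bar>t\<bar> + t) / 2\<close> and the negative part
    \<open>(\<bar>t\<bar> - t) / 2\<close>. Written with absolute values, the result is seen to lie
    in \<open>H\<close> by the closure rules.\<close>
  have inner: "E (\<lambda>\<omega>'. t * clip N (B \<omega>')) = ?a / 2 * (\<bar>t\<bar> + t) + ?b / 2 * (\<bar>t\<bar> + - t)" for t
  proof (cases "0 \<le> t")
    case True
    then show ?thesis using pos_homogeneous[OF clip_mem[OF B] True] by simp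
  next
    case False
    then show ?thesis
      using pos_homogeneous[OF minus_mem[OF clip_mem[OF B]], of "-t"] by simp
  qed
  have "E (\<lambda>\<omega>. E (\<lambda>\<omega>'. clip N (A \<omega>) * clip N (B \<omega>'))) \<le> E (\<lambda>\<omega>. d * \<bar>A \<omega>\<bar>)"
    unfolding inner
  proof (intro mono add_mem scale_mem abs_mem minus_mem clip_mem A)
    fix \<omega>
    let ?t = "clip N (A \<omega>)"
    have "?a / 2 * (\<bar>?t\<bar> + ?t) + ?b / 2 * (\<bar>?t\<bar> + - ?t)
        \<le> d / 2 * (\<bar>?t\<bar> + ?t) + d / 2 * (\<bar>?t\<bar> + - ?t)"
      using d by (intro add_mono mult_right_mono) auto
    also have "\<dots> = d * \<bar>?t\<bar>" by (simp add: algebra_simps)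
    also have "\<dots> \<le> d * \<bar>A \<omega>\<bar>" using d N by (intro mult_left_mono abs_clip_le_abs) auto
    finally show "?a / 2 * (\<bar>?t\<bar> + ?t) + ?b / 2 * (\<bar>?t\<bar> + - ?t) \<le> d * \<bar>A \<omega>\<bar>" .
  qed
  also have "\<dots> = d * E (\<lambda>\<omega>. \<bar>A \<omega>\<bar>)" using d by (intro pos_homogeneous abs_mem A)
  also have "\<dots> \<le> d * m" using d abs by (intro mult_left_mono) auto
  finally show ?thesis using mix by (simp add: mult.commute)
qed

lemma stationary_E_eq:
  fixes X :: "nat \<Rightarrow> 'w \<Rightarrow> real ^ 'd"
  assumes stat: "stationary E X" and "1 \<le> k"
    and g: "\<And>x y. \<bar>g x - g y\<bar> \<le> l * \<bar>x - y\<bar>"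
  shows "E (\<lambda>\<omega>. g (X k \<omega> $ i)) = E (\<lambda>\<omega>. g (X 1 \<omega> $ i))"
\<comment> \<open>Stationarity speaks only of shifts that are at least 1, so the shift by
  \<open>k - 1\<close> requires \<open>k \<noteq> 1\<close>.\<close>
proof (cases "k = 1")
  case False
  then have "identically_distributed E 1 (\<lambda>j. X 1) (\<lambda>j. X (k - 1 + 1))"
    using stat[unfolded stationary_def, rule_format, of 1 "k - 1" "\<lambda>_. 1"] \<open>1 \<le> k\<close> by auto
  moreover have "(\<lambda>z. g (z (0, i))) \<in> C_lip ({..<1::nat} \<times> UNIV)"
  proof -
    have "0 \<le> l" using g[of 1 0] by simp
    then have "\<bar>g (x (0, i)) - g (y (0, i))\<bar> \<le> l * (\<Sum>p\<in>{..<1} \<times> UNIV. \<bar>x p - y p\<bar>)" for x y :: "nat \<times> 'd \<Rightarrow> real"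
      by (intro order_trans[OF g] mult_left_mono member_le_sum) auto
    then show ?thesis by (auto simp: C_lip_def lipschitz_with_def)
  qed
  ultimately show ?thesis
    using \<open>1 \<le> k\<close> unfolding identically_distributed_def by fastforce
qed simp

section \<open>Strong law for one coordinate under a representing probability\<close>

text \<open>All moment and covariance estimates are made for \<open>E\<close> on elements of
  \<open>H\<close>; they pass to \<open>P\<close> because integrals under \<open>P\<close> are
  dominated by \<open>E\<close>.\<close>

lemma coordinate_strong_law:
  fixes X :: "nat \<Rightarrow> 'w \<Rightarrow> real ^ 'd"
  assumes mem: "\<And>k. 1 \<le> k \<Longrightarrow> vec_mem H (X k)"
    and stat: "stationary E X"
    and \<alpha>: "0 < \<alpha>" and mixing: "alpha_mixing E \<alpha> X"
    and sq: "(\<lambda>\<omega>. (norm1 (X 1 \<omega>))\<^sup>2) \<in> H"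
    and mean: "no_mean_uncertainty E (\<lambda>\<omega>. X 1 \<omega> $ i)"
    and P: "P \<in> representing_probs H E"
  shows "AE \<omega> in P. (\<lambda>n. (\<Sum>k=1..n. X k \<omega> $ i - E (\<lambda>\<omega>. X 1 \<omega> $ i)) / real n) \<longlonglongrightarrow> 0"
proof -
  define \<mu> where "\<mu> = E (\<lambda>\<omega>. X 1 \<omega> $ i)"
  define Y where "Y k \<omega> = X k \<omega> $ i - \<mu>" for k \<omega>
  \<comment> \<open>\<open>W\<close> stands in for the square of \<open>Y 1\<close>, which is not
    known to lie in \<open>H\<close>; it comes from
    \<open>(x - \<mu>)\<^sup>2 \<le> 2 * x\<^sup>2 + 2 * \<mu>\<^sup>2\<close> and
    \<open>\<bar>X 1 \<omega> $ i\<bar> \<le> norm1 (X 1 \<omega>)\<close>.\<close>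
  define W where "W \<omega> = 2 * (norm1 (X 1 \<omega>))\<^sup>2 + 2 * \<mu>\<^sup>2" for \<omega>
  have XH: "(\<lambda>\<omega>. X k \<omega> $ i) \<in> H" if "1 \<le> k" for k
    using mem[OF that] by (simp add: vec_mem_def)
  have YH: "Y k \<in> H" if "1 \<le> k" for k
    using add_mem[OF XH[OF that] const_mem[of "-\<mu>"]] by (simp add: Y_def[abs_def])
  have WH: "W \<in> H" unfolding W_def by (intro add_mem scale_mem sq const_mem)
  have YW: "(Y 1 \<omega>)\<^sup>2 \<le> W \<omega>" for \<omega>
  proof -
    have "\<bar>X 1 \<omega> $ i\<bar> \<le> norm1 (X 1 \<omega>)"
      unfolding norm1_def by (rule member_le_sum) auto
    then have "(X 1 \<omega> $ i)\<^sup>2 \<le> (norm1 (X 1 \<omega>))\<^sup>2"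
      by (metis abs_ge_zero power2_abs power_mono)
    moreover have "(Y 1 \<omega>)\<^sup>2 \<le> 2 * (X 1 \<omega> $ i)\<^sup>2 + 2 * \<mu>\<^sup>2"
      using zero_le_power2[of "X 1 \<omega> $ i + \<mu>"] by (simp add: Y_def power2_eq_square algebra_simps)
    ultimately show ?thesis by (simp add: W_def)
  qed
  have EW: "0 \<le> E W"
    using mono[OF const_mem[of 0] WH] const[of 0] by (simp add: W_def)
  \<comment> \<open>\<open>W\<close> dominates the square at index 1 only; bounds at the other
    indices are obtained by moving Lipschitz functions of \<open>Y k\<close> back to
    \<open>Y 1\<close>.\<close>
  have transfer: "E (\<lambda>\<omega>. g (Y k \<omega>)) = E (\<lambda>\<omega>. g (Y 1 \<omega>))"
    if "1 \<le> k" "\<And>x y. \<bar>g x - g y\<bar> \<le> l * \<bar>x - y\<bar>" for g l k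
    unfolding Y_def
    using stationary_E_eq[OF stat that(1), of "\<lambda>x. g (x - \<mu>)" l] that(2)[of "_ - \<mu>" "_ - \<mu>"] by simp

  \<comment> \<open>The bound for \<open>- Y k\<close> is where the absence of mean-uncertainty
    enters.\<close>
  have mean0: "E (Y k) \<le> 0" "E (\<lambda>\<omega>. - Y k \<omega>) \<le> 0" if "1 \<le> k" for k
  proof -
    have "E (Y k) = E (Y 1)"
      using transfer[OF that, of "\<lambda>x. x" 1] by simp
    also have "\<dots> \<le> E (\<lambda>\<omega>. X 1 \<omega> $ i) + E (\<lambda>_. - \<mu>)"
      using subadditive[OF XH[of 1] const_mem[of "-\<mu>"]] by (simp add: Y_def[abs_def])
    finally show "E (Y k) \<le> 0" by (simp add: const \<mu>_def)
    have "E (\<lambda>\<omega>. - Y k \<omega>) = E (\<lambda>\<omega>. - Y 1 \<omega>)"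
      using transfer[OF that, of "\<lambda>x. - x" 1] by simp
    also have "\<dots> \<le> E (\<lambda>\<omega>. - X 1 \<omega> $ i) + E (\<lambda>_. \<mu>)"
      using subadditive[OF minus_mem[OF XH[of 1]] const_mem[of "\<mu>"]] by (simp add: Y_def[abs_def])
    finally show "E (\<lambda>\<omega>. - Y k \<omega>) \<le> 0"
      using mean by (simp add: const no_mean_uncertainty_def \<mu>_def)
  qed
  have tail: "E (\<lambda>\<omega>. \<bar>Y k \<omega> - clip N (Y k \<omega>)\<bar>) \<le> E W / N" if "1 \<le> k" "0 < N" for k N
  proof -
    have "E (\<lambda>\<omega>. \<bar>Y k \<omega> - clip N (Y k \<omega>)\<bar>) = E (\<lambda>\<omega>. \<bar>Y 1 \<omega> - clip N (Y 1 \<omega>)\<bar>)"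
      by (rule transfer[OF that(1), where l=2]) (use clip_lipschitz in \<open>smt (verit)\<close>)
    also have "\<dots> \<le> E (\<lambda>\<omega>. 1 / N * W \<omega>)"
    proof (rule mono)
      show "(\<lambda>\<omega>. \<bar>Y 1 \<omega> - clip N (Y 1 \<omega>)\<bar>) \<in> H"
        using abs_mem[OF add_mem[OF YH[of 1] minus_mem[OF clip_mem[OF YH[of 1]]]]] by simp
      show "\<bar>Y 1 \<omega> - clip N (Y 1 \<omega>)\<bar> \<le> 1 / N * W \<omega>" for \<omega>
        using clip_tail[OF that(2), of "Y 1 \<omega>"] divide_right_mono[OF YW[of \<omega>], of N] that(2) by simp
    qed (intro scale_mem WH)
    also have "\<dots> = 1 / N * E W" using that by (intro pos_homogeneous WH) simp
    finally show ?thesis by simp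
  qed
  \<comment> \<open>Clip at level 1: the clipped part is at most 1 and the error has expectation at
    most \<open>E W\<close>.\<close>
  have EY: "E (\<lambda>\<omega>. \<bar>Y k \<omega>\<bar>) \<le> 1 + E W" if "1 \<le> k" for k
  proof -
    have t: "(\<lambda>\<omega>. \<bar>Y k \<omega> - clip 1 (Y k \<omega>)\<bar>) \<in> H"
      using abs_mem[OF add_mem[OF YH[OF that] minus_mem[OF clip_mem[OF YH[OF that]]]]] by simp
    have "E (\<lambda>\<omega>. \<bar>Y k \<omega>\<bar>) \<le> E (\<lambda>\<omega>. 1 + \<bar>Y k \<omega> - clip 1 (Y k \<omega>)\<bar>)"
    proof (rule mono[OF abs_mem[OF YH[OF that]] add_mem[OF const_mem t]])
      show "\<bar>Y k \<omega>\<bar> \<le> 1 + \<bar>Y k \<omega> - clip 1 (Y k \<omega>)\<bar>" for \<omega>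
        using abs_clip_le[of 1 "Y k \<omega>"] by linarith
    qed
    also have "\<dots> \<le> E (\<lambda>_. 1) + E (\<lambda>\<omega>. \<bar>Y k \<omega> - clip 1 (Y k \<omega>)\<bar>)"
      by (intro subadditive const_mem t)
    finally show ?thesis using tail[OF that, of 1] by (simp add: const)
  qed

  from mixing[unfolded alpha_mixing_def] obtain c where c: "0 < c" and mix: "\<forall>\<Lambda>1 \<Lambda>2.
      \<Lambda>1 \<noteq> {} \<and> finite \<Lambda>1 \<and> \<Lambda>1 \<subseteq> {1..} \<and> \<Lambda>2 \<noteq> {} \<and> finite \<Lambda>2 \<and> \<Lambda>2 \<subseteq> {1..} \<and>
      Max \<Lambda>1 \<le> Min \<Lambda>2 \<longrightarrow>
      (\<forall>\<phi> l. l > 0 \<and> lipschitz_with (UNIV :: ('d + 'd) set) l \<phi> \<longrightarrow>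
         \<bar>E (\<lambda>\<omega>. \<phi> (vec_pair (block_mean X \<Lambda>1 \<omega>) (block_mean X \<Lambda>2 \<omega>))) -
          E (\<lambda>\<omega>. E (\<lambda>\<omega>'. \<phi> (vec_pair (block_mean X \<Lambda>1 \<omega>) (block_mean X \<Lambda>2 \<omega>'))))\<bar>
         \<le> c * l * exp (- \<alpha> * \<bar>real (Min \<Lambda>2) - real (Max \<Lambda>1)\<bar>))"
    by (elim exE conjE) (rule that)
  have cov: "E (\<lambda>\<omega>. clip N (Y j \<omega>) * clip N (Y k \<omega>))
      \<le> (1 + E W) * E W / N + c * N * exp (- \<alpha>) ^ (k - j)"
    if N: "0 < N" and jk: "1 \<le> j" "j < k" for N j k
  proof -
    \<comment> \<open>Mixing is applied to the singleton blocks \<open>{j}\<close> and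
      \<open>{k}\<close>, whose block means are \<open>X j\<close> and \<open>X k\<close>;
      \<open>Inl i\<close> and \<open>Inr i\<close> select their coordinate
      \<open>i\<close>.\<close>
    define \<phi> where "\<phi> z = clip N (z (Inl i) - \<mu>) * clip N (z (Inr i) - \<mu>)" for z :: "'d + 'd \<Rightarrow> real"
    have "lipschitz_with UNIV N \<phi>"
      unfolding lipschitz_with_def
    proof (intro allI)
      fix x y :: "'d + 'd \<Rightarrow> real"
      have "\<bar>\<phi> x - \<phi> y\<bar> \<le> N * (\<bar>x (Inl i) - y (Inl i)\<bar> + \<bar>x (Inr i) - y (Inr i)\<bar>)"
        unfolding \<phi>_def using N by (intro order_trans[OF clip_mult_lipschitz]) auto
      also have "\<bar>x (Inl i) - y (Inl i)\<bar> + \<bar>x (Inr i) - y (Inr i)\<bar> = (\<Sum>p\<in>{Inl i, Inr i}. \<bar>x p - y p\<bar>)"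
        by simp
      also have "N * \<dots> \<le> N * (\<Sum>p\<in>UNIV. \<bar>x p - y p\<bar>)"
        using N by (intro mult_left_mono sum_mono2) auto
      finally show "\<bar>\<phi> x - \<phi> y\<bar> \<le> N * (\<Sum>p\<in>UNIV. \<bar>x p - y p\<bar>)" using N by simp
    qed
    then have "\<bar>E (\<lambda>\<omega>. clip N (Y j \<omega>) * clip N (Y k \<omega>)) -
        E (\<lambda>\<omega>. E (\<lambda>\<omega>'. clip N (Y j \<omega>) * clip N (Y k \<omega>')))\<bar>
        \<le> c * N * exp (- \<alpha> * \<bar>real k - real j\<bar>)"
      using mix[rule_format, of "{j}" "{k}" N \<phi>] N jk by (simp add: \<phi>_def block_mean_def vec_pair_def Y_def)
    moreover have "exp (- \<alpha> * \<bar>real k - real j\<bar>) = exp (- \<alpha>) ^ (k - j)"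
      using jk by (simp add: exp_of_nat_mult[symmetric] of_nat_diff mult.commute)
    ultimately have m: "\<bar>E (\<lambda>\<omega>. clip N (Y j \<omega>) * clip N (Y k \<omega>)) -
        E (\<lambda>\<omega>. E (\<lambda>\<omega>'. clip N (Y j \<omega>) * clip N (Y k \<omega>')))\<bar> \<le> c * N * exp (- \<alpha>) ^ (k - j)"
      by simp
    have k: "1 \<le> k" using jk by simp
    \<comment> \<open>Clipping is odd, so the tail bound for \<open>Y k\<close> also serves
      \<open>- Y k\<close>.\<close>
    have clip_minus: "clip N (- x) = - clip N x" for x using N by (auto simp: clip_def)
    have "\<bar>- x - - y\<bar> = \<bar>x - y\<bar>" for x y :: real by simp
    then have "E (\<lambda>\<omega>. \<bar>- Y k \<omega> - clip N (- Y k \<omega>)\<bar>) \<le> E W / N"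
      using tail[OF k N] by (simp only: clip_minus)
    then have "E (\<lambda>\<omega>. - clip N (Y k \<omega>)) \<le> E W / N"
      using E_clip_le[OF minus_mem[OF YH[OF k]] mean0(2)[OF k] N] by (simp only: clip_minus)
    moreover have "E (\<lambda>\<omega>. clip N (Y k \<omega>)) \<le> E W / N"
      using E_clip_le[OF YH[OF k] mean0(1)[OF k] N tail[OF k N]] .
    ultimately show ?thesis
      using E_product_clip_le[OF YH[OF jk(1)] YH[OF k] N _ _ _ EY[OF jk(1)] m, of "E W / N"] EW N by simp
  qed

  have ps: "prob_space P" and Pint: "\<And>Z. Z \<in> H \<Longrightarrow> integrable P Z"
    and PE: "\<And>Z. Z \<in> H \<Longrightarrow> integral\<^sup>L P Z \<le> E Z"
    using P by (auto simp: representing_probs_def)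
  interpret prob_space P by (rule ps)
  have Ymeas: "Y k \<in> borel_measurable P" if "1 \<le> k" for k
    using Pint[OF YH[OF that]] by auto
  \<comment> \<open>The clipped square lies in \<open>H\<close> and is Lipschitz, so it can be
    compared under \<open>E\<close>, moved to index 1 and dominated by \<open>W\<close>, uniformly
    in the clipping level.\<close>
  have clip_sq: "expectation (\<lambda>\<omega>. (clip (real m) (Y k \<omega>))\<^sup>2) \<le> E W" if "1 \<le> k" for k and m :: nat
  proof -
    have sqH: "(\<lambda>\<omega>. (clip (real m) (Y k \<omega>))\<^sup>2) \<in> H" if "1 \<le> k" for k
      using clip_mult_mem[OF YH[OF that] YH[OF that], of "real m"] by (simp add: power2_eq_square)
    have "expectation (\<lambda>\<omega>. (clip (real m) (Y k \<omega>))\<^sup>2) \<le> E (\<lambda>\<omega>. (clip (real m) (Y k \<omega>))\<^sup>2)"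
      by (rule PE[OF sqH[OF that]])
    also have "\<dots> = E (\<lambda>\<omega>. (clip (real m) (Y 1 \<omega>))\<^sup>2)"
    proof (rule transfer[OF that, where l="2 * real m"])
      show "\<bar>(clip (real m) x)\<^sup>2 - (clip (real m) y)\<^sup>2\<bar> \<le> 2 * real m * \<bar>x - y\<bar>" for x y
        using clip_mult_lipschitz[of "real m" x x y y] by (simp add: power2_eq_square algebra_simps)
    qed
    also have "\<dots> \<le> E W"
    proof (intro mono sqH WH)
      show "(clip (real m) (Y 1 \<omega>))\<^sup>2 \<le> W \<omega>" for \<omega>
        by (rule order_trans[OF _ YW]) (simp add: abs_le_square_iff[symmetric] abs_clip_le_abs)
    qed simp
    finally show ?thesis .
  qed
  have "AE \<omega> in P. (\<lambda>n. (\<Sum>k=1..n. Y k \<omega>) / real n) \<longlonglongrightarrow> 0"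
  proof (rule strong_law_of_clipped_covariances)
    show "integrable P (\<lambda>\<omega>. (Y k \<omega>)\<^sup>2)" "expectation (\<lambda>\<omega>. (Y k \<omega>)\<^sup>2) \<le> E W" if "1 \<le> k" for k
      by (rule square_integrable_of_clip[OF Ymeas[OF that] clip_sq[OF that]])+
    show "expectation (\<lambda>\<omega>. clip N (Y j \<omega>) * clip N (Y k \<omega>))
        \<le> (1 + E W) * E W / N + c * N * exp (- \<alpha>) ^ (k - j)" if "0 < N" "1 \<le> j" "j < k" for N j k
      using that by (intro order_trans[OF PE cov] clip_mult_mem YH) auto
  qed (use Ymeas c EW \<alpha> in auto)
  then show ?thesis unfolding Y_def \<mu>_def .
qed

end

section \<open>Quasi-sure convergence of the vector averages\<close>

theorem corollary1p11:
  fixes H :: "('w \<Rightarrow> real) set" and E :: "('w \<Rightarrow> real) \<Rightarrow> real"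
    and X :: "nat \<Rightarrow> 'w \<Rightarrow> real ^ 'd" and \<alpha> :: real
  assumes "regular_sublinear_expectation_space H E"
    and "\<And>k. k \<ge> 1 \<Longrightarrow> vec_mem H (X k)"
    and "stationary E X"
    and "\<alpha> > 0" and "alpha_mixing E \<alpha> X"
    and "(\<lambda>\<omega>. (norm1 (X 1 \<omega>))\<^sup>2) \<in> H"
    and "vec_no_mean_uncertainty E (X 1)"
  shows "quasi_surely H E
           (\<lambda>\<omega>. (\<lambda>n. (1 / real n) *\<^sub>R (\<Sum>k=1..n. X k \<omega>)) \<longlonglongrightarrow> vec_expectation E (X 1))"
proof -
  interpret regular_sublinear_expectation_space H E by fact
  let ?\<mu> = "vec_expectation E (X 1)"
  define S where "S i n \<omega> = (\<Sum>k=1..n. X k \<omega> $ i - ?\<mu> $ i) / real n" for i n \<omega>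
  \<comment> \<open>The convergence set itself is the witness: it does not depend on a probability,
    so it serves all representing ones at once.\<close>
  define A where "A = {\<omega>. \<forall>i. (\<lambda>n. S i n \<omega>) \<longlonglongrightarrow> 0}"
  have space: "space (sigma_of H) = UNIV" and sets: "sets (sigma_of H) = sigma_sets UNIV {Z -` B | Z B. Z \<in> H \<and> B \<in> sets borel}"
    by (simp_all add: sigma_of_def)
  have meas: "Z \<in> borel_measurable (sigma_of H)" if "Z \<in> H" for Z
    using that by (intro measurableI) (auto simp: space sets)
  have [measurable]: "S i n \<in> borel_measurable (sigma_of H)" for i n
  proof -
    have "(\<lambda>\<omega>. X k \<omega> $ i) \<in> borel_measurable (sigma_of H)" if "k \<in> {1..n}" for k
      using assms(2)[of k] that by (intro meas) (auto simp: vec_mem_def)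
    then show ?thesis unfolding S_def[abs_def]
      by (intro borel_measurable_divide borel_measurable_sum borel_measurable_diff) auto
  qed
  have "A = {\<omega>\<in>space (sigma_of H). \<forall>i. \<forall>p::nat. \<exists>m. \<forall>n\<ge>m. \<bar>S i n \<omega>\<bar> < inverse (real (Suc p))}"
    unfolding A_def space
    by (simp add: tendsto_0_iff_inverse_Suc)
  also have "\<dots> \<in> sets (sigma_of H)" by measurable
  finally have A: "A \<in> sets (sigma_of H)" .
  have null: "emeasure P (- A) = 0" if P: "P \<in> representing_probs H E" for P
  proof -
    have "AE \<omega> in P. (\<lambda>n. S i n \<omega>) \<longlonglongrightarrow> 0" for i
      using coordinate_strong_law[OF assms(2-6) _ P, of i] assms(7)
      by (simp add: S_def vec_expectation_def vec_no_mean_uncertainty_def)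
    \<comment> \<open>There are finitely many coordinates, so their null sets combine into
      one.\<close>
    then have "AE \<omega> in P. \<omega> \<in> A" by (simp add: A_def AE_all_countable)
    moreover have "sets P = sets (sigma_of H)" using P by (simp add: representing_probs_def)
    moreover from this have "space P = UNIV" using sets_eq_imp_space_eq space by metis
    ultimately show ?thesis
      using A by (subst (asm) AE_iff_measurable[where N="- A"]) (auto simp: Compl_eq_Diff_UNIV space[symmetric])
  qed
  have "(\<lambda>n. (1 / real n) *\<^sub>R (\<Sum>k=1..n. X k \<omega>)) \<longlonglongrightarrow> ?\<mu>" if "\<omega> \<in> A" for \<omega>
  proof (rule vec_tendstoI)
    fix i
    have "(\<lambda>n. S i n \<omega> + ?\<mu> $ i) \<longlonglongrightarrow> 0 + ?\<mu> $ i"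
      using that by (intro tendsto_add tendsto_const) (simp add: A_def)
    \<comment> \<open>Positive n is required: at n = 0 the left side is the coordinate of the mean,
      while the right side is 0.\<close>
    moreover have "\<forall>\<^sub>F n in sequentially.
        S i n \<omega> + ?\<mu> $ i = ((1 / real n) *\<^sub>R (\<Sum>k=1..n. X k \<omega>)) $ i"
      using eventually_gt_at_top[of 0]
      by eventually_elim (simp add: S_def sum_subtractf field_simps)
    ultimately show "(\<lambda>n. ((1 / real n) *\<^sub>R (\<Sum>k=1..n. X k \<omega>)) $ i) \<longlonglongrightarrow> ?\<mu> $ i"
      using Lim_transform_eventually by fastforce
  qed
  moreover have "(SUP P\<in>representing_probs H E. emeasure P (- A)) \<le> 0"
    by (rule SUP_least) (simp add: null)
  ultimately show ?thesis
    unfolding quasi_surely_def using A by (intro bexI[of _ A]) auto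
qed

end
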